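(* Let $a_0=0$ and let $(a_n)_{n\ge 1}$ be the increasing sequence of positive integers whose odd part is of the form $4k+1$; let $d_n=a_{n+1}-a_n$ and $\mathbf{d}'=(d_{n+1})_{n\ge 0}$. Define the morphism $f$ on $\{0,1,2,3\}^*$ by $f(0)=01$, $f(1)=21$, $f(2)=03$, $f(3)=23$, and the morphism $g:\{0,1,2,3\}^*\to\{1,2,3,4\}^*$ by $g(0)=121$, $g(1)=31$, $g(2)=13$, $g(3)=4$. Then $\mathbf{d}'=g(f^{\infty}(0))=\lim_{n\to\infty}g(f^{n}(0))$. In particular, $(d_n)_{n\ge 0}$ is morphic.
   Context: The odd part of a positive integer $m$ is $m/2^v$ with $2^v$ the largest power of $2$ dividing $m$. $f^{\infty}(0)$ denotes the infinite fixed point of $f$ beginning with $0$, i.e. the limit of the words $f^n(0)$ (each a prefix of the next). A sequence is morphic if it is the image under a coding (letter-to-letter map) of a fixed point of a morphism. *)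

theory Defs
  imports "HOL-Library.Omega_Words_Fun" "HOL-Library.Infinite_Set"
    "HOL-Computational_Algebra.Primes"
begin

text \<open>Finite words are lists and infinite words are functions on \<open>nat\<close>. A morphism is given by
  the images of the letters.\<close>

definition apply_morphism :: "('a \<Rightarrow> 'b list) \<Rightarrow> 'a list \<Rightarrow> 'b list" where
  "apply_morphism h w = concat (map h w)"

definition words_tendsto :: "(nat \<Rightarrow> 'a list) \<Rightarrow> 'a word \<Rightarrow> bool" where
  "words_tendsto W x \<longleftrightarrow>
     (\<forall>k. \<forall>\<^sub>F n in sequentially. k \<le> length (W n) \<and> take k (W n) = prefix k x)"

definition words_lim :: "(nat \<Rightarrow> 'a list) \<Rightarrow> 'a word" where
  "words_lim W = (THE x. words_tendsto W x)"

definition morphism_iter :: "('a \<Rightarrow> 'a list) \<Rightarrow> nat \<Rightarrow> 'a list \<Rightarrow> 'a list" where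
  "morphism_iter h n = (apply_morphism h ^^ n)"

text \<open>The infinite fixed point of \<open>h\<close> beginning with \<open>a\<close>; meaningful when \<open>h\<close> is prolongable
  on \<open>a\<close> (see below).\<close>

definition infinite_fixed_point :: "('a \<Rightarrow> 'a list) \<Rightarrow> 'a \<Rightarrow> 'a word" where
  "infinite_fixed_point h a = words_lim (\<lambda>n. morphism_iter h n [a])"

definition apply_morphism_inf :: "('a \<Rightarrow> 'b list) \<Rightarrow> 'a word \<Rightarrow> 'b word" where
  "apply_morphism_inf h x = words_lim (\<lambda>n. apply_morphism h (prefix n x))"

definition prolongable :: "('a \<Rightarrow> 'a list) \<Rightarrow> 'a \<Rightarrow> bool" where
  "prolongable h a \<longleftrightarrow> (\<exists>u. h a = a # u \<and> (\<forall>n. morphism_iter h n u \<noteq> []))"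

text \<open>The fixed point has to be generated by iterating a prolongable morphism on a finite alphabet:
  if arbitrary fixed points were allowed, the identity morphism would make every sequence over a
  finite alphabet morphic. Taking the alphabet inside \<open>nat\<close> is no restriction, since only its
  finiteness matters. The coding is the letter-to-letter map \<open>c\<close>.\<close>

definition morphic :: "(nat \<Rightarrow> 'b) \<Rightarrow> bool" where
  "morphic s \<longleftrightarrow>
     (\<exists>(A :: nat set) h a c.
        finite A \<and> (\<forall>b\<in>A. set (h b) \<subseteq> A) \<and> a \<in> A \<and> prolongable h a \<and>
        s = c \<circ> infinite_fixed_point h a)"

definition odd_part :: "nat \<Rightarrow> nat" where
  "odd_part m = m div 2 ^ multiplicity 2 m"

definition a_seq :: "nat \<Rightarrow> nat" where
  "a_seq n = (case n of 0 \<Rightarrow> 0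
     | Suc i \<Rightarrow> enumerate {m. 0 < m \<and> (\<exists>k. odd_part m = 4 * k + 1)} i)"

text \<open>The subtraction on \<open>nat\<close> is never truncated, because \<open>a_seq\<close> is increasing.\<close>

definition d_seq :: "nat \<Rightarrow> nat" where
  "d_seq n = a_seq (n + 1) - a_seq n"

definition d'_seq :: "nat \<Rightarrow> nat" where
  "d'_seq n = d_seq (n + 1)"

text \<open>The alphabet of both morphisms is \<open>{0, 1, 2, 3}\<close>; the empty images of all other numbers are
  irrelevant.\<close>

definition f_morphism :: "nat \<Rightarrow> nat list" where
  "f_morphism b =
     (if b = 0 then [0, 1] else if b = 1 then [2, 1] else if b = 2 then [0, 3]
      else if b = 3 then [2, 3] else [])"

definition g_morphism :: "nat \<Rightarrow> nat list" where
  "g_morphism b =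
     (if b = 0 then [1, 2, 1] else if b = 1 then [3, 1] else if b = 2 then [1, 3]
      else if b = 3 then [4] else [])"

text \<open>Limits are unique, and the iterates of a prolongable morphism do converge.\<close>

lemma words_tendsto_unique:
  assumes "words_tendsto W x" "words_tendsto W y"
  shows "x = y"
proof
  fix k
  have "\<forall>\<^sub>F n in sequentially. prefix (Suc k) x = prefix (Suc k) y"
    using assms[unfolded words_tendsto_def, THEN spec, of "Suc k"]
    by eventually_elim simp
  then have "prefix (Suc k) x = prefix (Suc k) y" by simp
  then show "x k = y k" by simp
qed

lemma words_lim_eqI: "words_tendsto W x \<Longrightarrow> words_lim W = x"
  unfolding words_lim_def by (blast intro: words_tendsto_unique)

lemma words_tendsto_prefix_chain:
  assumes step: "\<And>n. \<exists>v. v \<noteq> [] \<and> W (Suc n) = W n @ v"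
  shows "words_tendsto W (words_lim W)"
proof -
  have len: "n \<le> length (W n)" for n
  proof (induction n)
    case (Suc n)
    obtain v where "v \<noteq> []" "W (Suc n) = W n @ v" using step by blast
    with Suc show ?case by (cases v) auto
  qed simp
  have mono: "\<exists>v. W (n + i) = W n @ v" for n i
  proof (induction i)
    case (Suc i)
    then show ?case using step[of "n + i"] by auto
  qed simp
  define x where "x k = W (Suc k) ! k" for k
  have "take k (W n) = prefix k x" if "k \<le> n" for k n
  proof (rule nth_equalityI)
    show "length (take k (W n)) = length (prefix k x)" using len[of n] that by simp
  next
    fix i assume "i < length (take k (W n))"
    then have i: "i < k" by simp
    obtain v where "W (Suc i + (n - Suc i)) = W (Suc i) @ v" using mono by blast
    then have "W n = W (Suc i) @ v" using i that by simp
    then show "take k (W n) ! i = prefix k x ! i"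
      using i len[of "Suc i"] by (simp add: x_def nth_append)
  qed
  then have "words_tendsto W x"
    unfolding words_tendsto_def eventually_sequentially by (meson len order_trans)
  then show ?thesis using words_lim_eqI by metis
qed

lemma morphism_iter_append: "morphism_iter h n (u @ v) = morphism_iter h n u @ morphism_iter h n v"
  by (induction n) (simp_all add: morphism_iter_def apply_morphism_def)

lemma infinite_fixed_point_tendsto:
  assumes "prolongable h a"
  shows "words_tendsto (\<lambda>n. morphism_iter h n [a]) (infinite_fixed_point h a)"
  unfolding infinite_fixed_point_def
proof (rule words_tendsto_prefix_chain)
  fix n
  obtain u where u: "h a = a # u" "\<And>n. morphism_iter h n u \<noteq> []"
    using assms by (auto simp: prolongable_def)
  have "morphism_iter h (Suc n) [a] = morphism_iter h n ([a] @ u)"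
    by (simp add: morphism_iter_def funpow_swap1 apply_morphism_def u(1))
  then show "\<exists>v. v \<noteq> [] \<and> morphism_iter h (Suc n) [a] = morphism_iter h n [a] @ v"
    using u(2) by (auto simp only: morphism_iter_append)
qed

lemma prolongable_f_morphism: "prolongable f_morphism 0"
proof -
  have "morphism_iter f_morphism n [1] \<noteq> [] \<and> set (morphism_iter f_morphism n [1]) \<subseteq> {0, 1, 2, 3}"
    for n
  proof (induction n)
    case (Suc n)
    let ?w = "morphism_iter f_morphism n [1]"
    have *: "morphism_iter f_morphism (Suc n) [1] = apply_morphism f_morphism ?w"
      by (simp add: morphism_iter_def)
    obtain b w where w: "?w = b # w" using Suc by (cases ?w) auto
    then have "b \<in> {0, 1, 2, 3}" using Suc by auto
    then have "f_morphism b \<noteq> []" by (auto simp: f_morphism_def)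
    moreover have "set (f_morphism c) \<subseteq> {0, 1, 2, 3}" for c by (auto simp: f_morphism_def)
    ultimately show ?case unfolding * w apply_morphism_def by auto
  qed (simp add: morphism_iter_def)
  then show ?thesis unfolding prolongable_def by (intro exI[of _ "[1]"]) (simp add: f_morphism_def)
qed

end

theory Submission imports Defs begin

text \<open>Let \<open>S\<close> be the set of positive integers with odd part \<open>4k + 1\<close>. It contains every
  \<open>4j + 1\<close> and no \<open>4j + 3\<close>, and it contains \<open>4j + 2\<close> iff \<open>j\<close> is even and \<open>4j + 4\<close> iff
  \<open>j + 1 \<in> S\<close>. So the gaps between \<open>4j + 1\<close> and \<open>4j + 5\<close> form \<open>g(x\<^sub>j)\<close>, where \<open>x\<^sub>j\<close> encodes
  the parity of \<open>j\<close> and whether \<open>j + 1 \<in> S\<close>. The same rules show that \<open>f(x\<^sub>j)\<close>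
  consists of the terms of \<open>x\<close> with indices \<open>2j\<close> and \<open>2j + 1\<close>, that is, \<open>x = f\<^sup>\<infinity>(0)\<close>.

  For morphicity, one replaces each letter \<open>b\<close> by a block of \<open>|g(b)|\<close> distinct letters coded to
  \<open>g(b)\<close>. Since \<open>|g(f(b))| \<ge> |g(b)|\<close>, the block of \<open>f(b)\<close> can be cut into nonempty images for
  the letters of the block of \<open>b\<close>.\<close>

section \<open>Limits of words\<close>

lemma words_tendsto_map:
  assumes "words_tendsto W x"
  shows "words_tendsto (\<lambda>n. map c (W n)) (c \<circ> x)"
  unfolding words_tendsto_def
proof
  fix k
  have "\<forall>\<^sub>F n in sequentially. k \<le> length (W n) \<and> take k (W n) = prefix k x"
    using assms by (simp add: words_tendsto_def)
  then show "\<forall>\<^sub>F n in sequentially.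
      k \<le> length (map c (W n)) \<and> take k (map c (W n)) = prefix k (c \<circ> x)"
    by eventually_elim (simp add: take_map subsequence_def)
qed

lemma words_tendsto_subseq:
  assumes "words_tendsto W x" "filterlim s sequentially sequentially"
  shows "words_tendsto (\<lambda>n. W (s n)) x"
  using assms unfolding words_tendsto_def by (blast dest: eventually_compose_filterlim)

lemma words_tendsto_Cons:
  assumes "words_tendsto W x"
  shows "words_tendsto (\<lambda>n. a # W n) (a ## x)"
  unfolding words_tendsto_def
proof
  fix k
  have pre: "prefix (Suc j) (a ## x) = a # prefix j x" for j
    unfolding subsequence_def by (simp add: map_upt_Suc del: upt_Suc)
  \<comment> \<open>For \<open>k = 0\<close> the truncated \<open>k - 1\<close> is harmless, since
    the prefix asked for is empty.\<close>
  have "\<forall>\<^sub>F n in sequentially. k - 1 \<le> length (W n) \<and> take (k - 1) (W n) = prefix (k - 1) x"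
    using assms by (simp add: words_tendsto_def)
  then show "\<forall>\<^sub>F n in sequentially.
      k \<le> length (a # W n) \<and> take k (a # W n) = prefix k (a ## x)"
  proof eventually_elim
    case (elim n)
    then show ?case using pre by (cases k) (simp_all only: pre, simp_all)
  qed
qed

lemma words_tendsto_prefixes:
  assumes "\<And>n. prefix (length (W n)) x = W n" "\<And>n. n \<le> length (W n)"
  shows "words_tendsto W x"
  unfolding words_tendsto_def
proof
  fix k
  have "k \<le> length (W n) \<and> take k (W n) = prefix k x" if "k \<le> n" for n
  proof -
    have k: "k \<le> length (W n)" using assms(2)[of n] that by simp
    have "take k (W n) = take k (prefix (length (W n)) x)" using assms(1) by metis
    with k show ?thesis by (simp add: take_map)
  qed
  then show "\<forall>\<^sub>F n in sequentially. k \<le> length (W n) \<and> take k (W n) = prefix k x"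
    unfolding eventually_sequentially by blast
qed

lemma morphism_iter_Suc: "morphism_iter h (Suc n) w = apply_morphism h (morphism_iter h n w)"
  by (simp add: morphism_iter_def)

lemma apply_morphism_Cons: "apply_morphism h (a # w) = h a @ apply_morphism h w"
  by (simp add: apply_morphism_def)

lemma map_apply_morphism: "map c (apply_morphism h w) = apply_morphism (map c \<circ> h) w"
  by (simp add: apply_morphism_def map_concat)

lemma apply_morphism_comp:
  "apply_morphism k (apply_morphism h w) = apply_morphism (apply_morphism k \<circ> h) w"
  by (induction w) (simp_all add: apply_morphism_def)

lemma apply_morphism_cong:
  "(\<And>b. b \<in> set w \<Longrightarrow> h b = k b) \<Longrightarrow> apply_morphism h w = apply_morphism k w"
  by (simp add: apply_morphism_def cong: map_cong)

section \<open>Positive integers with odd part congruent to 1 modulo 4\<close>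

definition S41 :: "nat set" where
  "S41 = {m. 0 < m \<and> (\<exists>k. odd_part m = 4 * k + 1)}"

lemma odd_part_double: "0 < m \<Longrightarrow> odd_part (2 * m) = odd_part m"
  by (simp add: odd_part_def multiplicity_times_same)

lemma odd_part_odd: "odd m \<Longrightarrow> odd_part m = m"
  by (simp add: odd_part_def not_dvd_imp_multiplicity_0)

lemma double_in_S41: "2 * m \<in> S41 \<longleftrightarrow> m \<in> S41"
  by (cases "m = 0") (auto simp: S41_def odd_part_double)

lemma S41_1: "4 * j + 1 \<in> S41"
  by (simp add: S41_def odd_part_odd)

lemma S41_3: "4 * j + 3 \<notin> S41"
  by (simp add: S41_def odd_part_odd) presburger

lemma odd_in_S41: "2 * j + 1 \<in> S41 \<longleftrightarrow> even j"
proof (cases "even j")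
  case True
  then obtain i where "j = 2 * i" by blast
  then show ?thesis using S41_1[of i] by simp
next
  case False
  then obtain i where "j = 2 * i + 1" by (blast elim: oddE)
  then show ?thesis using S41_3[of i] by (simp add: numeral_3_eq_3)
qed

lemma S41_2: "4 * j + 2 \<in> S41 \<longleftrightarrow> even j"
  using double_in_S41[of "2 * j + 1"] odd_in_S41[of j] by simp

lemma S41_4: "4 * j + 4 \<in> S41 \<longleftrightarrow> j + 1 \<in> S41"
proof -
  have "4 * j + 4 = 2 * (2 * (j + 1))" by simp
  then show ?thesis by (simp only: double_in_S41)
qed

lemma infinite_S41: "infinite S41"
  unfolding infinite_nat_iff_unbounded_le
proof
  fix m
  show "\<exists>n\<ge>m. n \<in> S41" using S41_1[of m] by (intro exI[of _ "4 * m + 1"]) simp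
qed

lemma enumerate_Suc_eqI:
  fixes A :: "nat set"
  assumes "infinite A" "m \<in> A" "enumerate A n < m"
    "\<And>k. \<lbrakk>enumerate A n < k; k < m\<rbrakk> \<Longrightarrow> k \<notin> A"
  shows "enumerate A (Suc n) = m"
  unfolding enumerate_Suc''[OF assms(1)]
  using assms by (intro Least_equality) (auto simp: not_less[symmetric])

lemma a_seq_Suc: "a_seq (Suc n) = enumerate S41 n"
  by (simp add: a_seq_def S41_def)

lemma d'_seq_eq: "d'_seq n = enumerate S41 (Suc n) - enumerate S41 n"
  by (simp add: d'_seq_def d_seq_def a_seq_Suc)

lemma enumerate_S41_0: "enumerate S41 0 = 1"
  unfolding enumerate_0 using S41_1[of 0]
  by (intro Least_equality) (auto simp: S41_def)

text \<open>\<open>d'_seq\<close> lists the gaps inside \<open>S41\<close>; the convention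
  \<open>a_seq 0 = 0\<close> only adds the gap from 0 to the least element 1.\<close>

lemma d_seq_eq: "d_seq = 1 ## d'_seq"
proof
  fix n
  have "d_seq 0 = 1"
    using enumerate_S41_0 by (simp add: d_seq_def a_seq_Suc) (simp add: a_seq_def)
  then show "d_seq n = (1 ## d'_seq) n" by (cases n) (simp_all add: d'_seq_def)
qed

section \<open>The fixed point of \<open>f\<close>\<close>

definition window_code :: "nat \<Rightarrow> nat" where
  "window_code j = (if even j then 0 else 1) + (if j + 1 \<in> S41 then 0 else 2)"

text \<open>The first letter has even index and tests 2j + 1, so it is 0 or 2 by the parity of j.
  The second has odd index and tests 2(j + 1), so it is 1 or 3 by membership of j + 1.\<close>

lemma f_window_code: "f_morphism (window_code j) = [window_code (2 * j), window_code (2 * j + 1)]"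
  using odd_in_S41[of j] double_in_S41[of "j + 1"]
  by (auto simp: f_morphism_def window_code_def)

lemma f_prefix: "apply_morphism f_morphism (prefix n window_code) = prefix (2 * n) window_code"
  by (induction n) (simp_all add: apply_morphism_def f_window_code)

lemma f_iter: "morphism_iter f_morphism n [0] = prefix (2 ^ n) window_code"
proof (induction n)
  case 0
  show ?case using S41_1[of 0] by (simp add: morphism_iter_def window_code_def)
next
  case (Suc n)
  show ?case unfolding morphism_iter_Suc Suc.IH f_prefix by simp
qed

lemma window_code_eq: "infinite_fixed_point f_morphism 0 = window_code"
proof -
  have "words_tendsto (\<lambda>n. morphism_iter f_morphism n [0]) window_code"
    by (rule words_tendsto_prefixes) (simp_all add: f_iter less_imp_le)
  then show ?thesis unfolding infinite_fixed_point_def by (rule words_lim_eqI)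
qed

lemma g_window_code:
  assumes N: "enumerate S41 N = 4 * j + 1"
  defines "w \<equiv> g_morphism (window_code j)"
  shows "map d'_seq [N..<N + length w] = w \<and> enumerate S41 (N + length w) = 4 * (j + 1) + 1"
proof -
  note mem = S41_1[of j] S41_1[of "j + 1"] S41_2[of j] S41_3[of j] S41_4[of j]
  have succ: "enumerate S41 (Suc n) = m"
    if "enumerate S41 n = l" "m \<in> S41" "l < m" "\<forall>k\<in>{l<..<m}. k \<notin> S41" for n l m
    using that by (intro enumerate_Suc_eqI infinite_S41) auto
  \<comment> \<open>Of 4j + 1, ..., 4j + 5 only 4j + 2 and 4j + 4 are undetermined; the two bits of
    \<open>window_code j\<close> decide them.\<close>
  consider "even j" "j + 1 \<in> S41" | "odd j" "j + 1 \<in> S41"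
    | "even j" "j + 1 \<notin> S41" | "odd j" "j + 1 \<notin> S41" by blast
  then show ?thesis
  proof cases
    case 1
    have 2: "enumerate S41 (Suc N) = 4 * j + 2"
      by (rule succ[OF N]) (use mem 1 in auto)
    have 3: "enumerate S41 (Suc (Suc N)) = 4 * j + 4"
    proof (rule succ[OF 2])
      have "{4 * j + 2<..<4 * j + 4} = {4 * j + 3}" by auto
      then show "\<forall>k\<in>{4 * j + 2<..<4 * j + 4}. k \<notin> S41" using mem by simp
    qed (use mem 1 in auto)
    have 4: "enumerate S41 (Suc (Suc (Suc N))) = 4 * (j + 1) + 1"
      by (rule succ[OF 3]) (use mem in auto)
    show ?thesis using N 1 2 3 4
      by (simp add: w_def window_code_def g_morphism_def d'_seq_eq upt_conv_Cons)
  next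
    case 2
    have 3: "enumerate S41 (Suc N) = 4 * j + 4"
    proof (rule succ[OF N])
      have "{4 * j + 1<..<4 * j + 4} = {4 * j + 2, 4 * j + 3}" by auto
      then show "\<forall>k\<in>{4 * j + 1<..<4 * j + 4}. k \<notin> S41" using mem 2 by simp
    qed (use mem 2 in auto)
    have 4: "enumerate S41 (Suc (Suc N)) = 4 * (j + 1) + 1"
      by (rule succ[OF 3]) (use mem in auto)
    show ?thesis using N 2 3 4
      by (simp add: w_def window_code_def g_morphism_def d'_seq_eq upt_conv_Cons)
  next
    case 3
    have 2: "enumerate S41 (Suc N) = 4 * j + 2"
      by (rule succ[OF N]) (use mem 3 in auto)
    have 4: "enumerate S41 (Suc (Suc N)) = 4 * (j + 1) + 1"
    proof (rule succ[OF 2])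
      have "{4 * j + 2<..<4 * (j + 1) + 1} = {4 * j + 3, 4 * j + 4}" by auto
      then show "\<forall>k\<in>{4 * j + 2<..<4 * (j + 1) + 1}. k \<notin> S41" using mem 3 by simp
    qed (use mem in auto)
    show ?thesis using N 2 3 4
      by (simp add: w_def window_code_def g_morphism_def d'_seq_eq upt_conv_Cons)
  next
    case 4
    have 5: "enumerate S41 (Suc N) = 4 * (j + 1) + 1"
    proof (rule succ[OF N])
      have "{4 * j + 1<..<4 * (j + 1) + 1} = {4 * j + 2, 4 * j + 3, 4 * j + 4}" by auto
      then show "\<forall>k\<in>{4 * j + 1<..<4 * (j + 1) + 1}. k \<notin> S41" using mem 4 by simp
    qed (use mem in auto)
    show ?thesis using N 4 5
      by (simp add: w_def window_code_def g_morphism_def d'_seq_eq upt_conv_Cons)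
  qed
qed

text \<open>The second conjunct makes the induction work: it places 4n + 1 at the index where the
  next block of gaps starts.\<close>

lemma g_prefix:
  fixes n defines "w \<equiv> apply_morphism g_morphism (prefix n window_code)"
  shows "prefix (length w) d'_seq = w \<and> enumerate S41 (length w) = 4 * n + 1"
  unfolding w_def
proof (induction n)
  case 0
  show ?case by (simp add: apply_morphism_def enumerate_S41_0)
next
  case (Suc n)
  let ?u = "apply_morphism g_morphism (prefix n window_code)" and ?v = "g_morphism (window_code n)"
  have "apply_morphism g_morphism (prefix (Suc n) window_code) = ?u @ ?v"
    by (simp add: apply_morphism_def)
  moreover have "prefix (length (?u @ ?v)) d'_seq
      = prefix (length ?u) d'_seq @ map d'_seq [length ?u..<length ?u + length ?v]"
    unfolding length_append subsequence_append by (simp add: subsequence_def)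
  moreover have "map d'_seq [length ?u..<length ?u + length ?v] = ?v
      \<and> enumerate S41 (length ?u + length ?v) = 4 * (n + 1) + 1"
    using g_window_code Suc by blast
  ultimately show ?case using Suc by simp
qed

lemma length_g_prefix: "n \<le> length (apply_morphism g_morphism (prefix n window_code))"
proof (induction n)
  case (Suc n)
  have "0 < length (g_morphism (window_code n))"
    by (simp add: g_morphism_def window_code_def)
  then show ?case using Suc by (simp add: apply_morphism_def del: length_greater_0_conv)
qed simp

lemma g_prefixes_tendsto:
  "words_tendsto (\<lambda>n. apply_morphism g_morphism (prefix n window_code)) d'_seq"
  by (rule words_tendsto_prefixes[OF g_prefix[THEN conjunct1] length_g_prefix])

lemma g_iterates_tendsto:
  "words_tendsto (\<lambda>n. apply_morphism g_morphism (morphism_iter f_morphism n [0])) d'_seq"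
proof -
  \<comment> \<open>The n-th iterate is the prefix of length \<open>2 ^ n\<close>, so the iterates
    give a subsequence of the images of all prefixes.\<close>
  have "filterlim (\<lambda>n. 2 ^ n :: nat) sequentially sequentially"
    by (rule filterlim_at_top_mono[OF filterlim_ident]) (simp add: less_imp_le)
  from words_tendsto_subseq[OF g_prefixes_tendsto this] show ?thesis by (simp add: f_iter)
qed

section \<open>Morphicity\<close>

text \<open>The letters \<open>0, \<dots>, 7\<close> form the blocks \<open>012\<close>, \<open>34\<close>, \<open>56\<close>, \<open>7\<close> of \<open>0\<close>, \<open>1\<close>, \<open>2\<close>, \<open>3\<close>. To put
  the term \<open>d\<^sub>0\<close> in front, the leading \<open>0\<close> of the fixed point is replaced by \<open>89\<close>: the letter \<open>8\<close>
  maps to \<open>89\<close>, and \<open>9\<close> to what is left of the image \<open>01\<close> of \<open>0\<close>.\<close>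

definition block :: "nat \<Rightarrow> nat list" where
  "block b = [[0, 1, 2], [3, 4], [5, 6], [7]] ! b"

definition block_morphism :: "nat \<Rightarrow> nat list" where
  "block_morphism b =
     [[0, 1], [2], [3, 4], [5, 6], [3, 4], [0, 1, 2], [7], [5, 6, 7], [8, 9], [1]] ! b"

definition block_coding :: "nat \<Rightarrow> nat" where
  "block_coding b = [1, 2, 1, 3, 1, 1, 3, 4, 1, 1] ! b"

lemma block_morphism_letters:
  assumes "b < 10"
  shows "block_morphism b \<noteq> [] \<and> set (block_morphism b) \<subseteq> {..<10}"
proof -
  have "b = 0 \<or> b = 1 \<or> b = 2 \<or> b = 3 \<or> b = 4 \<or> b = 5 \<or> b = 6 \<or> b = 7 \<or> b = 8 \<or> b = 9"
    using assms by presburger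
  then show ?thesis by (elim disjE) (simp_all add: block_morphism_def)
qed

text \<open>The images of the letters of a block are consecutive pieces of the block word of
  \<open>f_morphism b\<close>: for b = 0, the word 01234 is cut into 01, 2, 34.\<close>

lemma block_morphism_block:
  "b < 4 \<Longrightarrow> apply_morphism block_morphism (block b) = apply_morphism block (f_morphism b)"
  by (auto simp: less_Suc_eq numeral_eq_Suc apply_morphism_def block_def block_morphism_def
      f_morphism_def)

lemma block_coding_block: "b < 4 \<Longrightarrow> map block_coding (block b) = g_morphism b"
  by (auto simp: less_Suc_eq numeral_eq_Suc block_def block_coding_def g_morphism_def)

lemma f_iter_letters: "set (morphism_iter f_morphism n [0]) \<subseteq> {..<4}"
  by (auto simp: f_iter window_code_def)

lemma block_f_iter_Suc:
  "apply_morphism block (morphism_iter f_morphism (Suc n) [0])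
   = apply_morphism block_morphism (apply_morphism block (morphism_iter f_morphism n [0]))"
  unfolding morphism_iter_Suc apply_morphism_comp
  using f_iter_letters[of n] by (intro apply_morphism_cong) (auto simp: block_morphism_block)

text \<open>The shift by 3 is the time 8 takes to grow through 89 and 891 to 8912, matching the
  block 012. After that 0t becomes 01t' and 89t becomes 891t', with t' the image of t, so the tails
  stay equal.\<close>

lemma block_morphism_iter:
  "\<exists>t. apply_morphism block (morphism_iter f_morphism n [0]) = 0 # t
     \<and> morphism_iter block_morphism (n + 3) [8] = 8 # 9 # t"
proof (induction n)
  case 0
  show ?case
    by (simp add: morphism_iter_def apply_morphism_def block_def block_morphism_def
        numeral_eq_Suc)
next
  case (Suc n)
  then obtain t where t: "apply_morphism block (morphism_iter f_morphism n [0]) = 0 # t"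
    "morphism_iter block_morphism (n + 3) [8] = 8 # 9 # t" by blast
  show ?case
    unfolding block_f_iter_Suc add_Suc morphism_iter_Suc[of block_morphism] t
    by (simp add: apply_morphism_Cons) (simp add: block_morphism_def)
qed

lemma block_morphism_prolongable: "prolongable block_morphism 8"
proof -
  \<comment> \<open>The bound on the letters is carried along because list indexing gives known
    images only below 10.\<close>
  have "morphism_iter block_morphism n [9] \<noteq> []
      \<and> set (morphism_iter block_morphism n [9]) \<subseteq> {..<10}" for n
  proof (induction n)
    case 0
    show ?case by (simp add: morphism_iter_def)
  next
    case (Suc n)
    then obtain b w where w: "morphism_iter block_morphism n [9] = b # w"
      by (meson neq_Nil_conv)
    have "\<forall>c\<in>set (b # w). c < 10" using Suc w by auto
    then show ?case using block_morphism_letters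
      unfolding morphism_iter_Suc w by (fastforce simp: apply_morphism_def)
  qed
  then show ?thesis
    unfolding prolongable_def by (intro exI[of _ "[9]"]) (simp add: block_morphism_def)
qed

lemma d_seq_eq_coding: "d_seq = block_coding \<circ> infinite_fixed_point block_morphism 8"
proof -
  let ?W = "\<lambda>n. map block_coding (morphism_iter block_morphism (n + 3) [8])"
  \<comment> \<open>Both 8 and 9 are coded to 1: 8 yields the extra term \<open>d_seq 0\<close>, and
    9 replaces the leading letter 0, also coded to 1.\<close>
  have "?W n = 1 # apply_morphism g_morphism (morphism_iter f_morphism n [0])" for n
  proof -
    obtain t where t: "apply_morphism block (morphism_iter f_morphism n [0]) = 0 # t"
      "morphism_iter block_morphism (n + 3) [8] = 8 # 9 # t" using block_morphism_iter by blast
    have "apply_morphism g_morphism (morphism_iter f_morphism n [0])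
        = map block_coding (apply_morphism block (morphism_iter f_morphism n [0]))"
      unfolding map_apply_morphism
      using f_iter_letters[of n] by (intro apply_morphism_cong) (auto simp: block_coding_block)
    then show ?thesis unfolding t by (simp add: block_coding_def)
  qed
  then have "words_tendsto ?W d_seq"
    using words_tendsto_Cons[OF g_iterates_tendsto] by (simp add: d_seq_eq)
  moreover have "words_tendsto ?W (block_coding \<circ> infinite_fixed_point block_morphism 8)"
    by (rule words_tendsto_subseq[OF words_tendsto_map[OF
          infinite_fixed_point_tendsto[OF block_morphism_prolongable]]])
      (rule filterlim_add_const_nat_at_top)
  ultimately show ?thesis by (rule words_tendsto_unique)
qed

lemma morphic_d_seq: "morphic d_seq"
  unfolding morphic_def
  using block_morphism_letters block_morphism_prolongable d_seq_eq_coding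
  by (intro exI[of _ "{..<10}"] exI[of _ block_morphism] exI[of _ 8] exI[of _ block_coding]) auto

theorem theorem11:
  shows "d'_seq = apply_morphism_inf g_morphism (infinite_fixed_point f_morphism 0)
    \<and> words_tendsto (\<lambda>n. apply_morphism g_morphism (morphism_iter f_morphism n [0])) d'_seq
    \<and> morphic d_seq"
  using words_lim_eqI[OF g_prefixes_tendsto] g_iterates_tendsto morphic_d_seq
  by (simp add: apply_morphism_inf_def window_code_eq)

end
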